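(* Let $\mathbb{X}$ and $\mathbb{Y}$ be two real vector spaces equipped with a bilinear form $\langle\cdot,\cdot\rangle:\mathbb{X}\times\mathbb{Y}\to\mathbb{R}$. Let $\mathbb{W}$ be a set. For any function $h:\mathbb{W}\to\overline{\mathbb{R}}$, any nonempty set $W\subset\mathbb{W}$ and any mapping $\theta:W\to\mathbb{X}$, we have the lower bound $$\sup_{y\in\mathbb{Y}}\Big(\big(-(\theta\rhd h)^{\star}(y)\big)\,\underset{\cdot}{+}\,\big(-\sigma_{-\theta(W)}(y)\big)\Big)\;\le\;\inf_{w\in W}h(w).$$
   Context: $\overline{\mathbb{R}}=[-\infty,+\infty]$. The Moreau lower addition $\underset{\cdot}{+}$ on $\overline{\mathbb{R}}$ extends the usual addition with $(+\infty)\underset{\cdot}{+}(-\infty)=(-\infty)\underset{\cdot}{+}(+\infty)=-\infty$. Infimal postcomposition: for $\theta:W\to\mathbb{X}$ and $h:\mathbb{W}\to\overline{\mathbb{R}}$ with $W\subset\mathbb{W}$, the function $\theta\rhd h:\mathbb{X}\to\overline{\mathbb{R}}$ is $(\theta\rhd h)(x)=\inf\{h(w): w\in W,\ \theta(w)=x\}$, with $\inf\emptyset=+\infty$. Fenchel conjugate of $f:\mathbb{X}\to\overline{\mathbb{R}}$: $f^{\star}(y)=\sup_{x\in\mathbb{X}}\big(\langle x,y\rangle\underset{\cdot}{+}(-f(x))\big)$ for $y\in\mathbb{Y}$. Support function of $X\subset\mathbb{X}$: $\sigma_X(y)=\sup_{x\in X}\langle x,y\rangle$ for $y\in\mathbb{Y}$.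 Here $-\theta(W)=\{-\theta(w):w\in W\}$. *)

theory Defs
  imports "HOL-Analysis.Analysis"
begin

(* The library addition on ereal is the upper one (PInf + MInf = PInf), hence the
   separate Moreau lower addition, for which MInf is absorbing. *)
definition lower_add :: "ereal \<Rightarrow> ereal \<Rightarrow> ereal"  (infixl "+\<^sub>L" 65) where
  "a +\<^sub>L b = (if a = -\<infinity> \<or> b = -\<infinity> then -\<infinity> else a + b)"

lemma lower_add_simps [simp]:
  "ereal r +\<^sub>L ereal s = ereal (r + s)"
  "-\<infinity> +\<^sub>L b = -\<infinity>"
  "a +\<^sub>L -\<infinity> = -\<infinity>"
  "\<infinity> +\<^sub>L ereal r = \<infinity>"
  "ereal r +\<^sub>L \<infinity> = \<infinity>"
  "\<infinity> +\<^sub>L \<infinity> = \<infinity>"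
  by (simp_all add: lower_add_def)

(* The values of theta outside W play no role; Inf {} is PInf in ereal. *)
definition inf_postcomp :: "'w set \<Rightarrow> ('w \<Rightarrow> 'x) \<Rightarrow> ('w \<Rightarrow> ereal) \<Rightarrow> 'x \<Rightarrow> ereal" where
  "inf_postcomp W \<theta> h x = Inf {h w | w. w \<in> W \<and> \<theta> w = x}"

definition fenchel_conj :: "('x \<Rightarrow> 'y \<Rightarrow> real) \<Rightarrow> ('x \<Rightarrow> ereal) \<Rightarrow> 'y \<Rightarrow> ereal" where
  "fenchel_conj B f y = (SUP x. ereal (B x y) +\<^sub>L (- f x))"

definition support_fun :: "('x \<Rightarrow> 'y \<Rightarrow> real) \<Rightarrow> 'x set \<Rightarrow> 'y \<Rightarrow> ereal" where
  "support_fun B X y = (SUP x\<in>X. ereal (B x y))"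

end

theory Submission
  imports Defs
begin

text \<open>Test both suprema at a single point: for \<open>w \<in> W\<close> the conjugate is at least
  \<open>\<langle>\<theta> w, y\<rangle> - h w\<close>, since the infimal postcomposition at \<open>\<theta> w\<close> is at most \<open>h w\<close>, and the
  support function of \<open>- \<theta> ` W\<close> is at least \<open>- \<langle>\<theta> w, y\<rangle>\<close>. The pairing
  terms are finite, so they cancel even when \<open>h w\<close> is infinite.\<close>

text \<open>If the left side is not -\<infinity>, neither \<open>a'\<close> nor \<open>b'\<close> is
  -\<infinity>, so both sides are ordinary sums.\<close>

lemma lower_add_mono:
  assumes "a \<le> a'" "b \<le> b'"
  shows "a +\<^sub>L b \<le> a' +\<^sub>L b'"
  using assms by (auto simp: lower_add_def intro: add_mono)

lemma lower_add_cancel: "- (ereal r +\<^sub>L (- c)) +\<^sub>L ereal r = c"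
  by (cases c) (simp_all add: lower_add_def)

lemma inf_postcomp_le: "w \<in> W \<Longrightarrow> inf_postcomp W \<theta> h (\<theta> w) \<le> h w"
  unfolding inf_postcomp_def by (rule Inf_lower) blast

text \<open>The bound \<open>c\<close> replaces \<open>f x\<close> because an infimal
  postcomposition is only known to lie below \<open>h w\<close>; it need not attain it.\<close>

lemma fenchel_conj_ge: "f x \<le> c \<Longrightarrow> ereal (B x y) +\<^sub>L (- c) \<le> fenchel_conj B f y"
  unfolding fenchel_conj_def by (rule SUP_upper2[of x]) (auto intro: lower_add_mono)

lemma support_fun_ge: "x \<in> X \<Longrightarrow> ereal (B x y) \<le> support_fun B X y"
  unfolding support_fun_def by (rule SUP_upper)

theorem proposition4:
  fixes B :: "'x::real_vector \<Rightarrow> 'y::real_vector \<Rightarrow> real"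
    and h :: "'w \<Rightarrow> ereal"
    and W :: "'w set"
    and \<theta> :: "'w \<Rightarrow> 'x"
  assumes "bilinear B"
    and "W \<noteq> {}"
  shows "(SUP y. (- fenchel_conj B (inf_postcomp W \<theta> h) y)
            +\<^sub>L (- support_fun B ((\<lambda>w. - \<theta> w) ` W) y))
         \<le> (INF w\<in>W. h w)"
proof (intro SUP_least INF_greatest)
  fix y w
  assume w: "w \<in> W"
  let ?b = "ereal (B (\<theta> w) y)"
  have conj: "?b +\<^sub>L (- h w) \<le> fenchel_conj B (inf_postcomp W \<theta> h) y"
    using w by (intro fenchel_conj_ge inf_postcomp_le)
  have "ereal (B (- \<theta> w) y) \<le> support_fun B ((\<lambda>w. - \<theta> w) ` W) y"
    using w by (intro support_fun_ge) blast
  \<comment> \<open>Linearity in the first argument turns the pairing with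
    \<open>- \<theta> w\<close> into \<open>- ?b\<close>; negating then reverses the
    inequality.\<close>
  then have supp: "- support_fun B ((\<lambda>w. - \<theta> w) ` W) y \<le> ?b"
    using bilinear_lneg[OF assms(1)] by (simp add: ereal_uminus_le_reorder)
  have "(- fenchel_conj B (inf_postcomp W \<theta> h) y)
      +\<^sub>L (- support_fun B ((\<lambda>w. - \<theta> w) ` W) y) \<le> - (?b +\<^sub>L (- h w)) +\<^sub>L ?b"
    using conj supp by (intro lower_add_mono) simp_all
  then show "(- fenchel_conj B (inf_postcomp W \<theta> h) y)
      +\<^sub>L (- support_fun B ((\<lambda>w. - \<theta> w) ` W) y) \<le> h w"
    by (simp add: lower_add_cancel)
qed

end
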